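(* Let $\mathbb{F}_q$ be a finite field of odd characteristic, let $\nu\ge 0$ be an integer and $\delta\in\{0,1,2\}$ with $2\nu+\delta\ge 2$. Then the orthogonal inner product graph $Oi(2\nu+\delta,q)$ is connected if and only if $2\nu+\delta\geq 3$. Moreover, if $Oi(2\nu+\delta,q)$ is connected, then $\mathrm{diam}\big(Oi(2\nu+\delta,q)\big)=4$.
   Context: Fix a non-square $z\in\mathbb{F}_q^*$. Let $S=S_{2\nu+\delta,\Delta}$ be the $(2\nu+\delta)\times(2\nu+\delta)$ nonsingular symmetric block matrix $$S_{2\nu+\delta,\Delta}=\begin{pmatrix}0&I^{(\nu)}&\\ I^{(\nu)}&0&\\ &&\Delta\end{pmatrix},$$ where $\Delta=\emptyset$ (omitted) if $\delta=0$, $\Delta=(1)$ or $(z)$ if $\delta=1$, and $\Delta=\mathrm{diag}(1,-z)$ if $\delta=2$. A subspace of the row space $\mathbb{F}_q^{(2\nu+\delta)}$ is identified with any matrix whose rows form a basis of it. The orthogonal inner product graph $Oi(2\nu+\delta,q)$ (with respect to $S$) has as vertices all non-trivial subspaces of $\mathbb{F}_q^{(2\nu+\delta)}$ (i.e. different from $0$ and from the whole space), with an edge between vertices $A$ and $B$ if and only if $AS\,{}^t\!B=0$. Loops are allowed ($A$ is adjacent to itself when $AS\,{}^t\!A=0$). The distance between two vertices is the number of edges in a shortest path between them, and the diameter is the greatest distance between two vertices. *)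

theory Defs
  imports
    "Jordan_Normal_Form.VS_Connect"
    "Graph_Theory.Digraph_Component"
    "Graph_Theory.Shortest_Path"
begin

text \<open>
  Throughout, \<open>\<F>\<^sub>q\<close> is a type \<open>'a :: {finite, field}\<close> and the row space
  \<open>\<F>\<^sub>q\<^sup>(\<^sup>n\<^sup>)\<close> is \<open>carrier_vec n\<close> with its vector space structure
  \<open>module_vec TYPE('a) n\<close>.
\<close>

inductive is_Delta :: "'a :: field \<Rightarrow> nat \<Rightarrow> 'a mat \<Rightarrow> bool" for z where
  zero: "is_Delta z 0 (0\<^sub>m 0 0)"
| one: "is_Delta z 1 (mat_of_rows_list 1 [[1]])"
| one_z: "is_Delta z 1 (mat_of_rows_list 1 [[z]])"
| two: "is_Delta z 2 (mat_of_rows_list 2 [[1, 0], [0, - z]])"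

definition S_mat :: "nat \<Rightarrow> 'a :: field mat \<Rightarrow> 'a mat" where
  "S_mat \<nu> \<Delta> = diag_block_mat
     [four_block_mat (0\<^sub>m \<nu> \<nu>) (1\<^sub>m \<nu>) (1\<^sub>m \<nu>) (0\<^sub>m \<nu> \<nu>), \<Delta>]"

definition nontrivial_subspaces :: "nat \<Rightarrow> 'a :: field vec set set" where
  "nontrivial_subspaces n =
     {W. VectorSpace.subspace class_ring W (module_vec TYPE('a) n) \<and>
         W \<noteq> {0\<^sub>v n} \<and> W \<noteq> carrier_vec n}"

text \<open>The rows of \<open>M\<close> form a basis of the subspace \<open>W\<close> of \<open>\<F>\<^sub>q\<^sup>(\<^sup>n\<^sup>)\<close>.\<close>

definition row_basis_mat :: "nat \<Rightarrow> 'a :: field vec set \<Rightarrow> 'a mat \<Rightarrow> bool" where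
  "row_basis_mat n W M \<longleftrightarrow>
     M \<in> carrier_mat (dim_row M) n \<and> distinct (rows M) \<and>
     LinearCombinations.module.lin_indpt class_ring (module_vec TYPE('a) n) (set (rows M)) \<and>
     vec_space.row_space n M = W"

text \<open>
  The condition \<open>A S \<^sup>tB = 0\<close>. By \<open>perp_iff\<close> below it may be tested on any choice of matrices
  representing the two subspaces.
\<close>

definition perp :: "nat \<Rightarrow> 'a :: field mat \<Rightarrow> 'a vec set \<Rightarrow> 'a vec set \<Rightarrow> bool" where
  "perp n S A B \<longleftrightarrow>
     (\<exists>M N. row_basis_mat n A M \<and> row_basis_mat n B N \<and>
        M * S * N\<^sup>T = 0\<^sub>m (dim_row M) (dim_row N))"

lemma mult_transpose_eq_0_iff:
  fixes S :: "'a :: field mat"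
  assumes M: "M \<in> carrier_mat a n" and N: "N \<in> carrier_mat b n" and S: "S \<in> carrier_mat n n"
  shows "M * S * N\<^sup>T = 0\<^sub>m a b \<longleftrightarrow> (\<forall>u\<in>set (rows M). \<forall>v\<in>set (rows N). u \<bullet> (S *\<^sub>v v) = 0)"
proof -
  have entry: "(M * S * N\<^sup>T) $$ (i, j) = row M i \<bullet> (S *\<^sub>v row N j)" if "i < a" "j < b" for i j
  proof -
    have "M * S * N\<^sup>T = M * (S * N\<^sup>T)"
      using M N S by (intro assoc_mult_mat[of _ a n _ n _ b]) auto
    moreover have "col (S * N\<^sup>T) j = S *\<^sub>v row N j"
      using that N S by (subst col_mult2[of _ n n _ b]) auto
    ultimately show ?thesis
      using that M N S by simp
  qed
  have "M * S * N\<^sup>T = 0\<^sub>m a b \<longleftrightarrow> (\<forall>i<a. \<forall>j<b. (M * S * N\<^sup>T) $$ (i, j) = 0)"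
    using M N S by (auto simp: mat_eq_iff)
  also have "\<dots> \<longleftrightarrow> (\<forall>i<a. \<forall>j<b. row M i \<bullet> (S *\<^sub>v row N j) = 0)"
    by (simp add: entry)
  also have "\<dots> \<longleftrightarrow> (\<forall>u\<in>set (rows M). \<forall>v\<in>set (rows N). u \<bullet> (S *\<^sub>v v) = 0)"
    using M N by (auto simp: rows_def)
  finally show ?thesis .
qed

lemma (in vec_space) span_orthogonal:
  assumes U: "U \<subseteq> carrier_vec n" and W: "W \<subseteq> carrier_vec n"
    and "\<forall>u\<in>U. \<forall>w\<in>W. u \<bullet> w = 0"
  shows "\<forall>u\<in>span U. \<forall>w\<in>W. u \<bullet> w = 0"
proof -
  let ?K = "{u \<in> carrier_vec n. \<forall>w\<in>W. u \<bullet> w = 0}"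
  have "submodule class_ring ?K V"
    using W by unfold_locales
      (auto simp: module_vec_simps class_ring_simps subset_iff add_scalar_prod_distrib[of _ n])
  then have "span U \<subseteq> ?K"
    using assms by (intro span_is_subset) auto
  then show ?thesis by auto
qed

lemma mult_transpose_eq_0_iff_subspaces:
  fixes S :: "'a :: field mat"
  assumes S: "S \<in> carrier_mat n n" and MA: "row_basis_mat n A M" and NB: "row_basis_mat n B N"
  shows "M * S * N\<^sup>T = 0\<^sub>m (dim_row M) (dim_row N) \<longleftrightarrow> (\<forall>u\<in>A. \<forall>v\<in>B. u \<bullet> (S *\<^sub>v v) = 0)"
proof -
  interpret vec_space "TYPE('a)" n .
  have M: "M \<in> carrier_mat (dim_row M) n" and A: "A = span (set (rows M))"
    and N: "N \<in> carrier_mat (dim_row N) n" and B: "B = span (set (rows N))"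
    using MA NB by (auto simp: row_basis_mat_def row_space_def)
  have rM: "set (rows M) \<subseteq> carrier_vec n" and rN: "set (rows N) \<subseteq> carrier_vec n"
    using rows_carrier[of M] rows_carrier[of N] carrier_matD(2)[OF M] carrier_matD(2)[OF N] by auto
  have AV: "A \<subseteq> carrier_vec n" and BV: "B \<subseteq> carrier_vec n"
    using rM rN A B span_is_subset2 by auto
  have adj: "u \<bullet> (S *\<^sub>v v) = v \<bullet> (S\<^sup>T *\<^sub>v u)" if "u \<in> carrier_vec n" "v \<in> carrier_vec n" for u v
    using that S by (metis comm_scalar_prod mult_mat_vec_carrier transpose_carrier_mat
        transpose_vec_mult_scalar)
  have "(\<forall>u\<in>set (rows M). \<forall>v\<in>set (rows N). u \<bullet> (S *\<^sub>v v) = 0) \<longleftrightarrow>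
        (\<forall>u\<in>A. \<forall>v\<in>B. u \<bullet> (S *\<^sub>v v) = 0)" (is "?L \<longleftrightarrow> ?R")
  proof
    assume ?L
    then have "\<forall>u\<in>A. \<forall>w\<in>(*\<^sub>v) S ` set (rows N). u \<bullet> w = 0"
      unfolding A using rM rN S by (intro span_orthogonal) auto
    then have "\<forall>v\<in>set (rows N). \<forall>w\<in>(*\<^sub>v) S\<^sup>T ` A. v \<bullet> w = 0"
      using AV rN by (auto simp: adj subset_iff)
    then have "\<forall>v\<in>B. \<forall>w\<in>(*\<^sub>v) S\<^sup>T ` A. v \<bullet> w = 0"
      unfolding B using rN AV S by (intro span_orthogonal) auto
    then show ?R
      using AV BV by (auto simp: adj subset_iff)
  next
    assume ?R
    then show ?L
      using in_own_span[OF rM] in_own_span[OF rN] unfolding A B by blast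
  qed
  then show ?thesis
    by (simp add: mult_transpose_eq_0_iff[OF M N S])
qed

lemma perp_iff:
  assumes "S \<in> carrier_mat n n" "row_basis_mat n A M" "row_basis_mat n B N"
  shows "perp n S A B \<longleftrightarrow> M * S * N\<^sup>T = 0\<^sub>m (dim_row M) (dim_row N)"
  using assms mult_transpose_eq_0_iff_subspaces unfolding perp_def by blast

text \<open>
  The graph is encoded as a digraph whose arcs are the ordered pairs of adjacent vertices; since
  \<open>S\<close> is symmetric, so is this digraph. Loops are kept.
\<close>

definition inner_product_graph ::
  "nat \<Rightarrow> 'a :: field mat \<Rightarrow> 'a vec set pair_pre_digraph" where
  "inner_product_graph n S =
     \<lparr> pverts = nontrivial_subspaces n,
       parcs = {(A, B). A \<in> nontrivial_subspaces n \<and> B \<in> nontrivial_subspaces n \<and> perp n S A B} \<rparr>"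

definition Oi :: "nat \<Rightarrow> nat \<Rightarrow> 'a :: field mat \<Rightarrow> 'a vec set pair_pre_digraph" where
  "Oi \<nu> \<delta> \<Delta> = inner_product_graph (2 * \<nu> + \<delta>) (S_mat \<nu> \<Delta>)"

definition graph_dist :: "('v, 'e) pre_digraph \<Rightarrow> 'v \<Rightarrow> 'v \<Rightarrow> ereal" where
  "graph_dist G u v = wf_digraph.\<mu> G (\<lambda>_. 1) u v"

text \<open>
  Distances are integers or \<open>\<infinity>\<close>, so a finite supremum is a greatest distance.
\<close>

definition diameter :: "('v, 'e) pre_digraph \<Rightarrow> ereal" where
  "diameter G = (SUP u \<in> verts G. SUP v \<in> verts G. graph_dist G u v)"

end

theory Submission
  imports Defs
begin

text \<open>
  Two subspaces are adjacent exactly when each lies in the orthogonal complement of the other with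
  respect to the bilinear form of \<open>S\<close>. The argument works for any nondegenerate symmetric form on
  an \<open>n\<close>-dimensional space, and the matrices \<open>S_mat \<nu> \<Delta>\<close> are of this kind.

  \<^item> For \<open>n \<ge> 3\<close>, a proper subspace \<open>A\<close> is orthogonal to some vector \<open>u \<noteq> 0\<close>, and \<open>B\<close> to some
    \<open>v \<noteq> 0\<close>. Two linear conditions on \<open>n\<close> unknowns leave a nonzero \<open>w\<close> orthogonal to both \<open>u\<close>
    and \<open>v\<close>, so the lines through \<open>u\<close>, \<open>w\<close> and \<open>v\<close> form a walk of length four from \<open>A\<close>
    to \<open>B\<close> (\<open>walk_length_4\<close>).

  \<^item> This cannot be improved. A hyperplane has a single neighbour, the line orthogonal to it
    (\<open>orthogonal_to_hyperplane\<close>). If \<open>u\<close> and \<open>v\<close> are linearly independent and not orthogonal, any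
    walk between their hyperplanes has to start at the line of \<open>u\<close> and to end at the line
    of \<open>v\<close>. These lines are different and not adjacent, so one more vertex is needed between them.

  \<^item> For \<open>n = 2\<close> every vertex is a line, and by \<open>unique_neighbour_dim_2\<close> it has only one
    neighbour. A component therefore has at most two vertices, while every plane contains at
    least three lines.
\<close>

section \<open>Subspaces and linear algebra\<close>

lemma subspaceI:
  fixes W :: "'a :: field vec set"
  assumes "W \<subseteq> carrier_vec n" and "0\<^sub>v n \<in> W"
    and "\<And>u v. u \<in> W \<Longrightarrow> v \<in> W \<Longrightarrow> u + v \<in> W"
    and "\<And>c u. u \<in> W \<Longrightarrow> c \<cdot>\<^sub>v u \<in> W"
  shows "VectorSpace.subspace class_ring W (module_vec TYPE('a) n)"
proof -
  interpret vec_space "TYPE('a)" n .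
  have "submodule class_ring W V"
    using assms by unfold_locales (auto simp: module_vec_simps class_ring_simps subset_iff)
  then show ?thesis
    by (auto simp: VectorSpace.subspace_def intro: vec_vs)
qed

lemma subspaceD:
  fixes W :: "'a :: field vec set"
  assumes "VectorSpace.subspace class_ring W (module_vec TYPE('a) n)"
  shows "W \<subseteq> carrier_vec n" and "0\<^sub>v n \<in> W"
    and "u \<in> W \<Longrightarrow> v \<in> W \<Longrightarrow> u + v \<in> W"
    and "u \<in> W \<Longrightarrow> c \<cdot>\<^sub>v u \<in> W"
proof -
  interpret vec_space "TYPE('a)" n .
  have sub: "submodule class_ring W V"
    using assms by (auto simp: VectorSpace.subspace_def)
  show W: "W \<subseteq> carrier_vec n"
    using submodule.subset[OF sub] by (simp add: module_vec_simps)
  show "u \<in> W \<Longrightarrow> v \<in> W \<Longrightarrow> u + v \<in> W"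
    using submodule.m_closed[OF sub] by (simp add: module_vec_simps)
  show "u \<in> W \<Longrightarrow> c \<cdot>\<^sub>v u \<in> W"
    using submodule.smult_closed[OF sub, of c u] by (simp add: module_vec_simps class_ring_simps)
  show "0\<^sub>v n \<in> W"
    using submodule.zero_closed[OF sub] by (simp add: module_vec_simps)
qed

text \<open>Padding the system with zero equations makes it square with vanishing determinant.\<close>

lemma exists_kernel_vector:
  fixes M :: "'a :: field mat"
  assumes M: "M \<in> carrier_mat r n" and "r < n"
  obtains v where "v \<in> carrier_vec n" "v \<noteq> 0\<^sub>v n" "M *\<^sub>v v = 0\<^sub>v r"
proof -
  define c where "c i = (if i < r then row M i else 0\<^sub>v n)" for i
  define N where "N = mat\<^sub>r n n (\<lambda>i. if i = n - 1 then 0\<^sub>v n else c i)"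
  have N: "N \<in> carrier_mat n n"
    by (simp add: N_def)
  have "det N = 0"
    unfolding N_def using M \<open>r < n\<close> by (intro det_row_0) (auto simp: c_def)
  then obtain v where v: "v \<in> carrier_vec n" "v \<noteq> 0\<^sub>v n" "N *\<^sub>v v = 0\<^sub>v n"
    using det_0_iff_vec_prod_zero_field[OF N] by blast
  have "(M *\<^sub>v v) $ i = 0" if "i < r" for i
  proof -
    have "row N i = c i"
      using that \<open>r < n\<close> M unfolding N_def
      by (subst row_mat_of_row_fun) (auto simp: c_def)
    then have "(M *\<^sub>v v) $ i = (N *\<^sub>v v) $ i"
      using that \<open>r < n\<close> M N by (simp add: c_def)
    then show ?thesis
      using v(3) that \<open>r < n\<close> by simp
  qed
  then have "M *\<^sub>v v = 0\<^sub>v r"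
    using M by (intro eq_vecI) auto
  with v that show thesis
    by blast
qed

text \<open>A maximal linearly independent subset of \<open>W\<close> spans \<open>W\<close>, and listing it gives the matrix.\<close>

lemma row_basis_mat_exists:
  fixes W :: "'a :: field vec set"
  assumes W: "VectorSpace.subspace class_ring W (module_vec TYPE('a) n)"
  obtains M where "row_basis_mat n W M"
proof -
  interpret vec_space "TYPE('a)" n .
  note Wc = subspaceD(1)[OF W]
  let ?P = "\<lambda>T. T \<subseteq> W \<and> lin_indpt T"
  \<comment> \<open>No independent set has more than \<open>n\<close> elements, so a largest one exists over any field.\<close>
  have "\<exists>U. finite U \<and> maximal U ?P"
  proof (rule maximal_exists[where N = n and B = "{}"])
    show "finite T \<and> card T \<le> n" if "?P T" for T
      using li_le_dim[of T] fin_dim_li_fin[of T] that Wc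
      by (auto simp: dim_is_n module_vec_simps)
    show "?P {}"
      by (auto simp: lin_dep_def)
  qed
  then obtain U where "finite U" and "maximal U ?P"
    by auto
  then have U: "finite U" "U \<subseteq> W" "lin_indpt U"
    and max: "\<And>T. T \<subseteq> W \<Longrightarrow> lin_indpt T \<Longrightarrow> U \<subseteq> T \<Longrightarrow> T = U"
    by (simp_all add: maximal_def)
  have Uc: "U \<subseteq> carrier_vec n"
    using U Wc by simp
  have "W \<subseteq> span U"
  proof
    fix w assume w: "w \<in> W"
    show "w \<in> span U"
    proof (rule ccontr)
      assume nin: "w \<notin> span U"
      then have "w \<notin> U"
        using Uc span_mem by auto
      moreover have "lin_indpt (U \<union> {w})"
        using lin_dep_iff_in_span[of U w] Uc U(3) nin w Wc \<open>w \<notin> U\<close>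
        by (simp add: subset_iff)
      ultimately show False
        using max[of "U \<union> {w}"] U(2) w by blast
    qed
  qed
  moreover have "span U \<subseteq> W"
    using W U(2) by (intro span_is_subset) (auto simp: VectorSpace.subspace_def)
  ultimately have span: "span U = W" by blast
  obtain us where us: "set us = U" "distinct us"
    using finite_distinct_list[OF U(1)] by blast
  have "rows (mat_of_rows n us) = us"
    using us(1) Uc by (intro rows_mat_of_rows) simp
  then have "row_basis_mat n W (mat_of_rows n us)"
    using us U(3) span by (simp add: row_basis_mat_def row_space_def)
  then show thesis by (rule that)
qed

text \<open>Otherwise the rows would be \<open>n\<close> independent vectors, hence span the whole space.\<close>

lemma dim_row_row_basis_mat_less:
  fixes W :: "'a :: field vec set"
  assumes M: "row_basis_mat n W M" and "W \<noteq> carrier_vec n"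
  shows "dim_row M < n"
proof -
  interpret vec_space "TYPE('a)" n .
  have Mc: "M \<in> carrier_mat (dim_row M) n" and dist: "distinct (rows M)"
    and li: "lin_indpt (set (rows M))" and W: "span (set (rows M)) = W"
    using M by (auto simp: row_basis_mat_def row_space_def)
  have rc: "set (rows M) \<subseteq> carrier_vec n"
    using rows_carrier[of M] carrier_matD(2)[OF Mc] by simp
  have card: "card (set (rows M)) = dim_row M"
    using dist by (simp add: distinct_card)
  have "dim_row M \<le> n"
    using li_le_dim(2)[OF fin_dim rc li] card by (simp add: dim_is_n)
  moreover have "dim_row M \<noteq> n"
  proof
    assume "dim_row M = n"
    then have "basis (set (rows M))"
      using rc li card by (intro dim_li_is_basis) (auto simp: dim_is_n)
    then show False
      using W assms(2) by (simp add: basis_def)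
  qed
  ultimately show ?thesis by simp
qed

lemma zero_smult_vec: "u \<in> carrier_vec n \<Longrightarrow> (0 :: 'a :: field) \<cdot>\<^sub>v u = 0\<^sub>v n"
  by (intro eq_vecI) auto

definition line :: "'a :: field vec \<Rightarrow> 'a vec set" where
  "line u = range (\<lambda>c. c \<cdot>\<^sub>v u)"

lemma line_self: "u \<in> line u"
  unfolding line_def by (rule range_eqI[of _ _ 1]) simp

text \<open>In dimension at least two, no line contains two different unit vectors.\<close>

lemma line_nontrivial:
  fixes u :: "'a :: field vec"
  assumes u: "u \<in> carrier_vec n" "u \<noteq> 0\<^sub>v n" and n: "2 \<le> n"
  shows "line u \<in> nontrivial_subspaces n"
proof -
  have "VectorSpace.subspace class_ring (line u) (module_vec TYPE('a) n)"
  proof (rule subspaceI)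
    show "0\<^sub>v n \<in> line u"
      unfolding line_def using u(1) by (intro range_eqI[of _ _ 0]) auto
    show "v + w \<in> line u" if "v \<in> line u" "w \<in> line u" for v w
      using that u(1) unfolding line_def by (auto simp: add_smult_distrib_vec[symmetric])
    show "c \<cdot>\<^sub>v v \<in> line u" if "v \<in> line u" for c v
      using that unfolding line_def by (auto simp: smult_smult_assoc)
  qed (use u in \<open>auto simp: line_def\<close>)
  moreover have "line u \<noteq> {0\<^sub>v n}"
    using line_self[of u] u by auto
  moreover have "line u \<noteq> carrier_vec n"
  proof
    assume "line u = carrier_vec n"
    then have "unit_vec n 0 \<in> line u" "unit_vec n 1 \<in> line u"
      by auto
    then obtain c d where c: "unit_vec n 0 = c \<cdot>\<^sub>v u" and d: "unit_vec n 1 = d \<cdot>\<^sub>v u"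
      by (auto simp: line_def)
    have "c * u $ 0 = 1" "c * u $ 1 = 0" "d * u $ 1 = 1"
      using arg_cong[OF c, of "\<lambda>x. x $ 0"] arg_cong[OF c, of "\<lambda>x. x $ 1"]
        arg_cong[OF d, of "\<lambda>x. x $ 1"] u n by auto
    then show False by auto
  qed
  ultimately show ?thesis
    by (simp add: nontrivial_subspaces_def)
qed

lemma nontrivial_subspace_nonzero:
  assumes "A \<in> nontrivial_subspaces n"
  obtains a where "a \<in> A" "a \<in> carrier_vec n" "a \<noteq> 0\<^sub>v n"
  using assms subspaceD(1,2)[of A n] unfolding nontrivial_subspaces_def by blast

section \<open>Nondegenerate symmetric forms\<close>

locale nondegenerate_symmetric_form =
  fixes n :: nat and S :: "'a :: field mat"
  assumes S: "S \<in> carrier_mat n n" and symmetric: "S\<^sup>T = S" and det: "det S \<noteq> 0"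
begin

definition form :: "'a vec \<Rightarrow> 'a vec \<Rightarrow> 'a" where
  "form u v = u \<bullet> (S *\<^sub>v v)"

definition orthogonal_hyperplane :: "'a vec \<Rightarrow> 'a vec set" where
  "orthogonal_hyperplane u = {x \<in> carrier_vec n. form x u = 0}"

lemma form_commute:
  assumes "u \<in> carrier_vec n" "v \<in> carrier_vec n"
  shows "form u v = form v u"
proof -
  have "form u v = (S *\<^sub>v v) \<bullet> u"
    unfolding form_def using assms S by (intro comm_scalar_prod) auto
  also have "\<dots> = v \<bullet> (S\<^sup>T *\<^sub>v u)"
    using assms S symmetric by (metis transpose_vec_mult_scalar)
  finally show ?thesis
    by (simp add: form_def symmetric)
qed

lemma form_add_left:
  "u \<in> carrier_vec n \<Longrightarrow> v \<in> carrier_vec n \<Longrightarrow> w \<in> carrier_vec n \<Longrightarrow>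
    form (u + v) w = form u w + form v w"
  unfolding form_def using S by (intro add_scalar_prod_distrib) auto

lemma form_smult_left:
  "u \<in> carrier_vec n \<Longrightarrow> v \<in> carrier_vec n \<Longrightarrow> form (c \<cdot>\<^sub>v u) v = c * form u v"
  unfolding form_def using S by simp

lemma form_smult_right:
  "u \<in> carrier_vec n \<Longrightarrow> v \<in> carrier_vec n \<Longrightarrow> form u (c \<cdot>\<^sub>v v) = c * form u v"
  using form_commute[of u] form_smult_left[of v u] by simp

lemma form_add_right:
  "u \<in> carrier_vec n \<Longrightarrow> v \<in> carrier_vec n \<Longrightarrow> w \<in> carrier_vec n \<Longrightarrow>
    form w (u + v) = form w u + form w v"
  using form_commute[of w] form_add_left[of u v w] by simp

lemma form_zero_left: "v \<in> carrier_vec n \<Longrightarrow> form (0\<^sub>v n) v = 0"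
  unfolding form_def using S by simp

lemma S_mult_nonzero:
  assumes "u \<in> carrier_vec n" "u \<noteq> 0\<^sub>v n"
  shows "S *\<^sub>v u \<noteq> 0\<^sub>v n"
  using det_0_iff_vec_prod_zero_field[OF S] det assms by blast

lemma form_unit_vec:
  assumes "i < n" "u \<in> carrier_vec n"
  shows "form (unit_vec n i) u = (S *\<^sub>v u) $ i"
  unfolding form_def using assms S by simp

lemma nondegenerate:
  assumes u: "u \<in> carrier_vec n" and orth: "\<And>x. x \<in> carrier_vec n \<Longrightarrow> form x u = 0"
  shows "u = 0\<^sub>v n"
proof (rule ccontr)
  assume "u \<noteq> 0\<^sub>v n"
  moreover have "S *\<^sub>v u = 0\<^sub>v n"
    using orth[of "unit_vec n i" for i] form_unit_vec[OF _ u] S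
    by (intro eq_vecI) auto
  ultimately show False
    using S_mult_nonzero u by blast
qed

text \<open>
  If \<open>v\<close> is not orthogonal to \<open>u\<close>, the formula \<open>x - (form x u / form v u) v\<close> splits off from any \<open>x\<close> a component in the hyperplane,
  so \<open>form x c\<close> is a fixed multiple of \<open>form x u\<close>. This is the statement that the orthogonal
  complement of a hyperplane is a line, without any dimension count.
\<close>

lemma orthogonal_to_hyperplane:
  assumes u: "u \<in> carrier_vec n" "u \<noteq> 0\<^sub>v n" and c: "c \<in> carrier_vec n"
    and orth: "\<And>x. x \<in> orthogonal_hyperplane u \<Longrightarrow> form x c = 0"
  shows "c \<in> line u"
proof -
  obtain v where v: "v \<in> carrier_vec n" and vu: "form v u \<noteq> 0"
    using nondegenerate[OF u(1)] u(2) by blast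
  define s where "s = form v c / form v u"
  have "form x (c + (- s) \<cdot>\<^sub>v u) = 0" if x: "x \<in> carrier_vec n" for x
  proof -
    define y where "y = x + (- (form x u / form v u)) \<cdot>\<^sub>v v"
    have y: "y \<in> carrier_vec n"
      using x v by (simp add: y_def)
    have expand: "form y w = form x w - form x u / form v u * form v w"
      if "w \<in> carrier_vec n" for w
      unfolding y_def using x v that by (subst form_add_left) (auto simp: form_smult_left)
    have "form y c = 0"
      using y expand[OF u(1)] vu by (intro orth) (simp add: orthogonal_hyperplane_def)
    then have "form x c = s * form x u"
      using expand[OF c] by (simp add: s_def)
    moreover have "form x (c + (- s) \<cdot>\<^sub>v u) = form x c - s * form x u"
      using x u c by (simp add: form_add_right form_smult_right)
    ultimately show ?thesis by simp
  qed
  then have "c + (- s) \<cdot>\<^sub>v u = 0\<^sub>v n"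
    using u c by (intro nondegenerate) auto
  then have "c = s \<cdot>\<^sub>v u"
    using u c by (auto simp: vec_eq_iff)
  then show ?thesis
    by (auto simp: line_def)
qed

text \<open>
  The vectors orthogonal to \<open>A\<close> solve a homogeneous linear system with one equation for each
  element of a basis of \<open>A\<close>. As \<open>A\<close> is proper, there are fewer than \<open>n\<close> equations.
\<close>

lemma exists_orthogonal_to_subspace:
  assumes A: "A \<in> nontrivial_subspaces n"
  obtains v where "v \<in> carrier_vec n" "v \<noteq> 0\<^sub>v n" "\<And>a. a \<in> A \<Longrightarrow> form a v = 0"
proof -
  interpret vec_space "TYPE('a)" n .
  obtain M where M: "row_basis_mat n A M"
    using A row_basis_mat_exists by (auto simp: nontrivial_subspaces_def)
  have Mc: "M \<in> carrier_mat (dim_row M) n" and span: "A = span (set (rows M))"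
    using M by (auto simp: row_basis_mat_def row_space_def)
  have "dim_row M < n"
    using dim_row_row_basis_mat_less[OF M] A by (simp add: nontrivial_subspaces_def)
  moreover have "M * S \<in> carrier_mat (dim_row M) n"
    using Mc S by (rule mult_carrier_mat)
  ultimately obtain v where v: "v \<in> carrier_vec n" "v \<noteq> 0\<^sub>v n" "(M * S) *\<^sub>v v = 0\<^sub>v (dim_row M)"
    using exists_kernel_vector by metis
  have Sv: "S *\<^sub>v v \<in> carrier_vec n"
    using S v by simp
  have "M *\<^sub>v (S *\<^sub>v v) = 0\<^sub>v (dim_row M)"
    using v assoc_mult_mat_vec[OF Mc S v(1)] by simp
  then have "row M i \<bullet> (S *\<^sub>v v) = 0" if "i < dim_row M" for i
    using that by (metis index_mult_mat_vec index_zero_vec(1))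
  then have "\<forall>u\<in>set (rows M). \<forall>w\<in>{S *\<^sub>v v}. u \<bullet> w = 0"
    by (auto simp: rows_def)
  then have "\<forall>u\<in>A. \<forall>w\<in>{S *\<^sub>v v}. u \<bullet> w = 0"
    unfolding span using rows_carrier[of M] Mc Sv by (intro span_orthogonal) auto
  then show thesis
    using that v by (auto simp: form_def)
qed

lemma exists_orthogonal_to_pair:
  assumes uv: "u \<in> carrier_vec n" "v \<in> carrier_vec n" and n: "3 \<le> n"
  obtains w where "w \<in> carrier_vec n" "w \<noteq> 0\<^sub>v n" "form w u = 0" "form w v = 0"
proof -
  let ?M = "mat_of_rows n [S *\<^sub>v u, S *\<^sub>v v]"
  have Sc: "S *\<^sub>v u \<in> carrier_vec n" "S *\<^sub>v v \<in> carrier_vec n"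
    using S uv by auto
  have M: "?M \<in> carrier_mat 2 n"
    by (intro carrier_matI) simp_all
  have "2 < n"
    using n by simp
  from exists_kernel_vector[OF M this]
  obtain w where w: "w \<in> carrier_vec n" "w \<noteq> 0\<^sub>v n" and Mw: "?M *\<^sub>v w = 0\<^sub>v 2" .
  have "row ?M 0 = S *\<^sub>v u" "row ?M 1 = S *\<^sub>v v"
    using Sc by simp_all
  then have "(?M *\<^sub>v w) $ 0 = (S *\<^sub>v u) \<bullet> w" "(?M *\<^sub>v w) $ 1 = (S *\<^sub>v v) \<bullet> w"
    by simp_all
  then have "(S *\<^sub>v u) \<bullet> w = 0" "(S *\<^sub>v v) \<bullet> w = 0"
    by (simp_all add: Mw)
  then have "form w u = 0" "form w v = 0"
    unfolding form_def using comm_scalar_prod[OF w(1)] Sc by simp_all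
  with w that show thesis by blast
qed

lemma orthogonal_hyperplane_nontrivial:
  assumes u: "u \<in> carrier_vec n" "u \<noteq> 0\<^sub>v n" and n: "3 \<le> n"
  shows "orthogonal_hyperplane u \<in> nontrivial_subspaces n"
proof -
  have "VectorSpace.subspace class_ring (orthogonal_hyperplane u) (module_vec TYPE('a) n)"
    using u by (intro subspaceI)
      (auto simp: orthogonal_hyperplane_def form_zero_left form_add_left form_smult_left)
  moreover have "orthogonal_hyperplane u \<noteq> {0\<^sub>v n}"
    using exists_orthogonal_to_pair[OF u(1) u(1) n] by (auto simp: orthogonal_hyperplane_def)
  moreover have "orthogonal_hyperplane u \<noteq> carrier_vec n"
    using nondegenerate[OF u(1)] u(2) by (auto simp: orthogonal_hyperplane_def)
  ultimately show ?thesis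
    by (simp add: nontrivial_subspaces_def)
qed

section \<open>The inner product graph of a form\<close>

abbreviation G where "G \<equiv> with_proj (inner_product_graph n S)"

abbreviation adjacent where "adjacent A B \<equiv> (A, B) \<in> parcs (inner_product_graph n S)"

lemma perp_iff_form:
  assumes "A \<in> nontrivial_subspaces n" "B \<in> nontrivial_subspaces n"
  shows "perp n S A B \<longleftrightarrow> (\<forall>a\<in>A. \<forall>b\<in>B. form a b = 0)"
proof -
  obtain M N where "row_basis_mat n A M" "row_basis_mat n B N"
    using assms row_basis_mat_exists by (metis (no_types, lifting) mem_Collect_eq nontrivial_subspaces_def)
  then show ?thesis
    using perp_iff[OF S] mult_transpose_eq_0_iff_subspaces[OF S] by (simp add: form_def)
qed

lemma verts_G: "pverts (inner_product_graph n S) = nontrivial_subspaces n"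
  by (simp add: inner_product_graph_def)

lemma adjacent_iff:
  "adjacent A B \<longleftrightarrow>
    A \<in> nontrivial_subspaces n \<and> B \<in> nontrivial_subspaces n \<and> (\<forall>a\<in>A. \<forall>b\<in>B. form a b = 0)"
  by (auto simp: inner_product_graph_def perp_iff_form)

lemma nontrivial_subspace_carrier: "A \<in> nontrivial_subspaces n \<Longrightarrow> a \<in> A \<Longrightarrow> a \<in> carrier_vec n"
  using subspaceD(1)[of A n] by (auto simp: nontrivial_subspaces_def)

lemma adjacent_sym: "adjacent A B \<Longrightarrow> adjacent B A"
  using form_commute nontrivial_subspace_carrier unfolding adjacent_iff by (metis (no_types))

lemma wf_G: "wf_digraph G"
  by unfold_locales (auto simp: inner_product_graph_def)

sublocale wf_digraph G
  by (rule wf_G)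

lemma adjacent_line:
  assumes "A \<in> nontrivial_subspaces n" "u \<in> carrier_vec n" "u \<noteq> 0\<^sub>v n" "2 \<le> n"
    and "\<And>a. a \<in> A \<Longrightarrow> form a u = 0"
  shows "adjacent A (line u)"
proof -
  have "form a x = 0" if "a \<in> A" "x \<in> line u" for a x
    using that assms(2,5) nontrivial_subspace_carrier[OF assms(1)]
    by (auto simp: line_def form_smult_right)
  then show ?thesis
    using assms(1) line_nontrivial[OF assms(2-4)] by (simp add: adjacent_iff)
qed

text \<open>
  The middle vertex is a line orthogonal to two given lines, which is where \<open>n \<ge> 3\<close> enters.
\<close>

lemma walk_length_4:
  assumes n: "3 \<le> n" and A: "A \<in> nontrivial_subspaces n" and B: "B \<in> nontrivial_subspaces n"
  obtains C D E where "adjacent A C" "adjacent C D" "adjacent D E" "adjacent E B"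
proof -
  obtain u where u: "u \<in> carrier_vec n" "u \<noteq> 0\<^sub>v n" "\<And>a. a \<in> A \<Longrightarrow> form a u = 0"
    using exists_orthogonal_to_subspace[OF A] by blast
  obtain v where v: "v \<in> carrier_vec n" "v \<noteq> 0\<^sub>v n" "\<And>b. b \<in> B \<Longrightarrow> form b v = 0"
    using exists_orthogonal_to_subspace[OF B] by blast
  obtain w where w: "w \<in> carrier_vec n" "w \<noteq> 0\<^sub>v n" "form w u = 0" "form w v = 0"
    using exists_orthogonal_to_pair[OF u(1) v(1) n] by blast
  have n2: "2 \<le> n"
    using n by simp
  have "form x u = 0" "form x v = 0" if "x \<in> line w" for x
    using that u(1) v(1) w by (auto simp: line_def form_smult_left)
  then have "adjacent (line w) (line u)" "adjacent (line w) (line v)"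
    using adjacent_line[OF line_nontrivial[OF w(1,2) n2]] u(1,2) v(1,2) n2 by simp_all
  then show thesis
    using that adjacent_line[OF A u(1,2) n2 u(3)] adjacent_line[OF B v(1,2) n2 v(3)] adjacent_sym
    by blast
qed

lemma connected_inner_product_graph:
  assumes n: "3 \<le> n"
  shows "Digraph_Component.connected G"
proof -
  have "u \<rightarrow>\<^sup>*\<^bsub>G\<^esub> v" if uv: "u \<in> verts G" "v \<in> verts G" for u v
  proof -
    have "u \<in> nontrivial_subspaces n" "v \<in> nontrivial_subspaces n"
      using uv by (simp_all add: verts_G)
    from walk_length_4[OF n this]
    obtain C D E where "adjacent u C" "adjacent C D" "adjacent D E" "adjacent E v" .
    then show ?thesis
      by (metis adj_reachable_trans reachable_adjI with_proj_simps(3))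
  qed
  moreover have "verts G \<noteq> {}"
    using line_nontrivial[of "unit_vec n 0" n] n by (auto simp: verts_G)
  ultimately show ?thesis
    unfolding Digraph_Component.connected_def strongly_connected_def
    using reachable_mk_symmetricI by auto
qed

text \<open>
  Distances are infima over walks, with loops and repeated vertices permitted. All arcs have
  cost one, so these infima can be bounded through lengths of walks.
\<close>

lemma graph_dist_le:
  assumes "awalk u p v"
  shows "graph_dist G u v \<le> length p"
  using min_cost_le_walk_cost[OF assms, of "\<lambda>_. 1"]
  by (simp add: graph_dist_def awalk_cost_def sum_list_triv)

lemma graph_dist_ge:
  assumes "\<And>p. awalk u p v \<Longrightarrow> k \<le> length p"
  shows "k \<le> graph_dist G u v"
  unfolding graph_dist_def \<mu>_def
  using assms by (intro INF_greatest) (auto simp: awalk_cost_def sum_list_triv)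

text \<open>
  Distance four is attained by the orthogonal hyperplanes of two independent vectors \<open>u\<close>
  and \<open>v\<close> that are not orthogonal to each other. Shorter walks are excluded one length at a time:
  the second vertex must lie inside the line of \<open>u\<close>, the last but one inside the line of \<open>v\<close>.
\<close>

lemma diameter_inner_product_graph:
  assumes n: "3 \<le> n"
  shows "diameter G = 4"
proof (rule antisym)
  show "diameter G \<le> 4"
    unfolding diameter_def
  proof (intro SUP_least)
    fix A B assume "A \<in> verts G" "B \<in> verts G"
    then have AB: "A \<in> nontrivial_subspaces n" "B \<in> nontrivial_subspaces n"
      by (simp_all add: verts_G)
    from walk_length_4[OF n this]
    obtain C D E where w: "adjacent A C" "adjacent C D" "adjacent D E" "adjacent E B" .
    then have "awalk A [(A, C), (C, D), (D, E), (E, B)] B"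
      using AB by (simp add: awalk_def cas.simps verts_G)
    from graph_dist_le[OF this] show "graph_dist G A B \<le> 4"
      by simp
  qed
next
  define u :: "'a vec" where "u = unit_vec n 0"
  have u: "u \<in> carrier_vec n" "u \<noteq> 0\<^sub>v n" "u $ 1 = 0"
    using n by (auto simp: u_def)
  \<comment> \<open>The second coordinate of \<open>v\<close> is kept nonzero so that \<open>v\<close> is not a multiple of \<open>u\<close>.\<close>
  obtain v where v: "v \<in> carrier_vec n" "v $ 1 \<noteq> 0" "form v u \<noteq> 0"
  proof (cases "form (unit_vec n 1) u = 0")
    case False
    then show thesis
      using n by (intro that[of "unit_vec n 1"]) auto
  next
    case True
    obtain i where i: "i < n" "(S *\<^sub>v u) $ i \<noteq> 0"
      using S_mult_nonzero[OF u(1,2)] S by (auto simp: vec_eq_iff)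
    then have "form (unit_vec n i + unit_vec n 1) u \<noteq> 0" "i \<noteq> 1"
      using True n u form_unit_vec[of _ u] by (auto simp: form_add_left)
    then show thesis
      using i n by (intro that[of "unit_vec n i + unit_vec n 1"]) auto
  qed
  have v0: "v \<noteq> 0\<^sub>v n"
    using v n by auto
  have uv: "form u v \<noteq> 0"
    using form_commute[OF u(1) v(1)] v(3) by simp
  let ?A = "orthogonal_hyperplane u" and ?B = "orthogonal_hyperplane v"
  have A: "?A \<in> verts G" and B: "?B \<in> verts G"
    using orthogonal_hyperplane_nontrivial[OF _ _ n] u v v0 by (auto simp: verts_G)
  have neighbour_A: "c \<in> line u" if "adjacent ?A C" "c \<in> C" for c C
    using that orthogonal_to_hyperplane[OF u(1,2)] nontrivial_subspace_carrier
    unfolding adjacent_iff by blast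
  have neighbour_B: "d \<in> line v" if "adjacent D ?B" "d \<in> D" for d D
    using that adjacent_sym[OF that(1)] orthogonal_to_hyperplane[OF v(1) v0] nontrivial_subspace_carrier
    unfolding adjacent_iff by blast
  have walk_ge_4: "4 \<le> length p" if p: "awalk ?A p ?B" for p
  proof (rule ccontr)
    assume "\<not> 4 \<le> length p"
    then have "length p = 0 \<or> length p = 1 \<or> length p = 2 \<or> length p = 3"
      by arith
    then consider (walk0) "?A = ?B" | (walk1) "adjacent ?A ?B"
      | (walk2) C where "adjacent ?A C" "adjacent C ?B"
      | (walk3) C D where "adjacent ?A C" "adjacent C D" "adjacent D ?B"
      using p by (auto simp: length_Suc_conv numeral_2_eq_2 numeral_3_eq_3 awalk_def cas.simps)
    then show False
    proof cases
      case walk0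
      have "u \<in> line v"
        using walk0 u by (intro orthogonal_to_hyperplane[OF v(1) v0])
          (auto simp: orthogonal_hyperplane_def)
      then obtain s where "u = s \<cdot>\<^sub>v v"
        by (auto simp: line_def)
      then show False
        using u v n by auto
    next
      case walk1
      \<comment> \<open>The hyperplanes have a common nonzero vector \<open>w\<close>. As a member of a neighbour of \<open>?A\<close> it would
        lie on the line of \<open>u\<close>, which meets the hyperplane of \<open>v\<close> only in zero.\<close>
      obtain w where w: "w \<in> carrier_vec n" "w \<noteq> 0\<^sub>v n" "form w u = 0" "form w v = 0"
        using exists_orthogonal_to_pair[OF u(1) v(1) n] by blast
      then have "w \<in> line u"
        by (intro neighbour_A[OF walk1]) (simp add: orthogonal_hyperplane_def)
      then obtain s where s: "w = s \<cdot>\<^sub>v u"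
        by (auto simp: line_def)
      have "s * form u v = 0"
        using w(4) s form_smult_left[OF u(1) v(1)] by simp
      then have "s = 0"
        using uv by simp
      then show False
        using zero_smult_vec[OF u(1)] w(2) s by simp
    next
      case walk2
      then have "C \<in> nontrivial_subspaces n"
        by (simp add: adjacent_iff)
      then obtain c where c: "c \<in> C" "c \<noteq> 0\<^sub>v n"
        by (blast elim: nontrivial_subspace_nonzero)
      obtain s t where s: "c = s \<cdot>\<^sub>v u" and t: "c = t \<cdot>\<^sub>v v"
        using neighbour_A[OF walk2(1) c(1)] neighbour_B[OF walk2(2) c(1)]
        unfolding line_def by blast
      have "c $ 1 = s * u $ 1"
        unfolding s using u(1) n by simp
      moreover have "c $ 1 = t * v $ 1"
        unfolding t using v(1) n by simp
      ultimately have "t = 0"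
        using u(3) v(2) by simp
      then show False
        using zero_smult_vec[OF v(1)] t c(2) by simp
    next
      case walk3
      then have CD: "C \<in> nontrivial_subspaces n" "D \<in> nontrivial_subspaces n"
        by (simp_all add: adjacent_iff)
      obtain c where c: "c \<in> C" "c \<noteq> 0\<^sub>v n"
        using CD(1) by (blast elim: nontrivial_subspace_nonzero)
      obtain d where d: "d \<in> D" "d \<noteq> 0\<^sub>v n"
        using CD(2) by (blast elim: nontrivial_subspace_nonzero)
      obtain s t where st: "c = s \<cdot>\<^sub>v u" "d = t \<cdot>\<^sub>v v"
        using neighbour_A[OF walk3(1) c(1)] neighbour_B[OF walk3(3) d(1)]
        unfolding line_def by blast
      have "form c d = 0"
        using walk3(2) c(1) d(1) by (simp add: adjacent_iff)
      then have "s = 0 \<or> t = 0"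
        using st u(1) v(1) uv by (auto simp: form_smult_left form_smult_right)
      then show False
        using zero_smult_vec[OF u(1)] zero_smult_vec[OF v(1)] st c(2) d(2) by auto
    qed
  qed
  then have "ereal 4 \<le> graph_dist G ?A ?B"
    using graph_dist_ge[of ?A ?B 4] by simp
  also have "\<dots> \<le> diameter G"
    unfolding diameter_def by (intro SUP_upper2[OF A] SUP_upper[OF B])
  finally show "4 \<le> diameter G"
    by simp
qed

text \<open>
  In the plane, vectors orthogonal to a common \<open>a \<noteq> 0\<close> satisfy one nontrivial linear equation, so any
  two of them have a vanishing cross product and are proportional. Exchanging \<open>B\<close> and \<open>C\<close> gives
  equality.
\<close>

lemma unique_neighbour_dim_2:
  assumes n: "n = 2" and AB: "adjacent A B" and AC: "adjacent A C"
  shows "C \<subseteq> B"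
proof
  fix c assume c: "c \<in> C"
  obtain a where a: "a \<in> A" "a \<in> carrier_vec n" "a \<noteq> 0\<^sub>v n"
    using AB nontrivial_subspace_nonzero unfolding adjacent_iff by blast
  obtain b where b: "b \<in> B" "b \<in> carrier_vec n" "b \<noteq> 0\<^sub>v n"
    using AB nontrivial_subspace_nonzero unfolding adjacent_iff by blast
  have cc: "c \<in> carrier_vec n"
    using AC c nontrivial_subspace_carrier unfolding adjacent_iff by blast
  define w where "w = S *\<^sub>v a"
  have w: "w \<in> carrier_vec 2" "w \<noteq> 0\<^sub>v 2"
    using S_mult_nonzero[OF a(2,3)] S a n by (auto simp: w_def)
  have dot: "x $ 0 * w $ 0 + x $ 1 * w $ 1 = 0" if "x \<in> carrier_vec 2" "form a x = 0" for x
  proof -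
    have "x \<bullet> w = 0"
      using that form_commute[of a x] a n by (simp add: form_def w_def)
    then show ?thesis
      using w(1) by (simp add: scalar_prod_def numeral_2_eq_2)
  qed
  have "b $ 0 * w $ 0 + b $ 1 * w $ 1 = 0" "c $ 0 * w $ 0 + c $ 1 * w $ 1 = 0"
    using dot[of b] dot[of c] AB AC a b c cc n unfolding adjacent_iff by auto
  moreover have
    "w $ 0 * (b $ 0 * c $ 1 - b $ 1 * c $ 0) =
      c $ 1 * (b $ 0 * w $ 0 + b $ 1 * w $ 1) - b $ 1 * (c $ 0 * w $ 0 + c $ 1 * w $ 1)"
    "w $ 1 * (b $ 0 * c $ 1 - b $ 1 * c $ 0) =
      b $ 0 * (c $ 0 * w $ 0 + c $ 1 * w $ 1) - c $ 0 * (b $ 0 * w $ 0 + b $ 1 * w $ 1)"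
    by (simp_all add: algebra_simps)
  ultimately have "w $ 0 * (b $ 0 * c $ 1 - b $ 1 * c $ 0) = 0"
    "w $ 1 * (b $ 0 * c $ 1 - b $ 1 * c $ 0) = 0"
    by simp_all
  moreover have "w $ 0 \<noteq> 0 \<or> w $ 1 \<noteq> 0"
    using w by (auto simp: vec_eq_iff less_2_cases_iff)
  ultimately have cross: "b $ 0 * c $ 1 = b $ 1 * c $ 0"
    by auto
  have "\<exists>t. c = t \<cdot>\<^sub>v b"
  proof (cases "b $ 0 = 0")
    case True
    then have "b $ 1 \<noteq> 0"
      using b n by (auto simp: vec_eq_iff less_2_cases_iff)
    then have "c = (c $ 1 / b $ 1) \<cdot>\<^sub>v b"
      using b cc n cross True by (auto simp: vec_eq_iff less_2_cases_iff)
    then show ?thesis ..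
  next
    case False
    then have "c = (c $ 0 / b $ 0) \<cdot>\<^sub>v b"
      using b cc n cross by (auto simp: vec_eq_iff less_2_cases_iff field_simps)
    then show ?thesis ..
  qed
  then show "c \<in> B"
    using AB b subspaceD(4)[of B n] unfolding adjacent_iff nontrivial_subspaces_def by blast
qed

text \<open>
  The line \<open>X\<close> spanned by the first unit vector has a unique neighbour \<open>Y\<close>, whose unique neighbour
  is \<open>X\<close> again. So walks from \<open>X\<close> never leave \<open>{X, Y}\<close>, and of the three lines chosen one is missed.
\<close>

lemma not_connected_dim_2:
  assumes n: "n = 2"
  shows "\<not> Digraph_Component.connected G"
proof
  assume conn: "Digraph_Component.connected G"
  have "Digraph.symmetric G"
    using adjacent_sym unfolding Digraph.symmetric_def by (auto intro: symI)
  then have reach: "A \<rightarrow>\<^sup>*\<^bsub>G\<^esub> B" if "A \<in> verts G" "B \<in> verts G" for A B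
    using symmetric_connected_imp_strongly_connected[OF _ conn] that
    unfolding strongly_connected_def by blast
  let ?e = "unit_vec 2 0 :: 'a vec" and ?f = "unit_vec 2 1 :: 'a vec"
  define X where "X = line ?e"
  have "?e \<noteq> 0\<^sub>v 2" "?f \<noteq> 0\<^sub>v 2" "?e + ?f \<noteq> 0\<^sub>v 2"
    by (auto simp: vec_eq_iff less_2_cases_iff)
  then have lines: "X \<in> verts G" "line ?f \<in> verts G" "line (?e + ?f) \<in> verts G"
    using n unfolding X_def by (auto simp: verts_G[unfolded n] intro!: line_nontrivial)
  have distinct: "X \<noteq> line ?f" "X \<noteq> line (?e + ?f)" "line ?f \<noteq> line (?e + ?f)"
  proof -
    have cross: "x $ 0 * y $ 1 = x $ 1 * y $ 0" if "x \<in> line y" "y \<in> carrier_vec 2" for x y :: "'a vec"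
      using that by (auto simp: line_def)
    have "?f \<notin> line ?e" "?e + ?f \<notin> line ?e" "?f \<notin> line (?e + ?f)"
      using cross[of ?f ?e] cross[of "?e + ?f" ?e] cross[of ?f "?e + ?f"] by auto
    then show "X \<noteq> line ?f" "X \<noteq> line (?e + ?f)" "line ?f \<noteq> line (?e + ?f)"
      using line_self[of "?e + ?f"] line_self[of ?f] by (auto simp: X_def)
  qed
  have "X \<in> nontrivial_subspaces n"
    using lines by (simp add: verts_G)
  then obtain u where u: "u \<in> carrier_vec n" "u \<noteq> 0\<^sub>v n" "\<And>x. x \<in> X \<Longrightarrow> form x u = 0"
    using exists_orthogonal_to_subspace by blast
  define Y where "Y = line u"
  have XY: "adjacent X Y"
    unfolding Y_def using u n \<open>X \<in> nontrivial_subspaces n\<close> by (intro adjacent_line) auto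
  have unique: "C = B" if "adjacent A B" "adjacent A C" for A B C
    using that unique_neighbour_dim_2[OF n] by blast
  have "Z \<in> {X, Y}" if "X \<rightarrow>\<^sup>*\<^bsub>G\<^esub> Z" for Z
    using that
  proof (induction rule: reachable_induct)
    case (step A B)
    then show ?case
      using unique XY adjacent_sym[OF XY] by auto
  qed simp
  then have "line ?f \<in> {X, Y}" "line (?e + ?f) \<in> {X, Y}"
    using reach lines by blast+
  with distinct show False by auto
qed

end

section \<open>The orthogonal inner product graph\<close>

lemma is_Delta_carrier: "is_Delta z \<delta> \<Delta> \<Longrightarrow> \<Delta> \<in> carrier_mat \<delta> \<delta>"
  by (induction rule: is_Delta.induct) (auto simp: mat_of_rows_list_def)

lemma is_Delta_symmetric: "is_Delta z \<delta> \<Delta> \<Longrightarrow> \<Delta>\<^sup>T = \<Delta>"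
  by (induction rule: is_Delta.induct)
    (auto simp: mat_eq_iff mat_of_rows_list_def numeral_2_eq_2 less_Suc_eq)

lemma is_Delta_det:
  assumes "is_Delta z \<delta> \<Delta>" "z \<noteq> 0"
  shows "det \<Delta> \<noteq> 0"
  using assms
proof (induction rule: is_Delta.induct)
  case two
  let ?D = "mat_of_rows_list 2 [[1, 0], [0, - z]]"
  have "upper_triangular ?D" "?D \<in> carrier_mat 2 2"
    by (auto simp: upper_triangular_def mat_of_rows_list_def numeral_2_eq_2 less_Suc_eq)
  moreover have "diag_mat ?D = [1, - z]"
    by (simp add: diag_mat_def mat_of_rows_list_def numeral_2_eq_2)
  ultimately show ?case
    using two det_upper_triangular by fastforce
qed (auto simp: det_single mat_of_rows_list_def)

text \<open>
  The hyperbolic block \<open>H\<close> is its own inverse, so \<open>det H\<close> is a unit whatever its sign is, and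
  \<open>det S = det H * det \<Delta>\<close>.
\<close>

lemma nondegenerate_symmetric_form_S_mat:
  fixes z :: "'a :: field"
  assumes \<Delta>: "is_Delta z \<delta> \<Delta>" and z: "z \<noteq> 0"
  shows "nondegenerate_symmetric_form (2 * \<nu> + \<delta>) (S_mat \<nu> \<Delta>)"
proof -
  define H :: "'a mat" where "H = four_block_mat (0\<^sub>m \<nu> \<nu>) (1\<^sub>m \<nu>) (1\<^sub>m \<nu>) (0\<^sub>m \<nu> \<nu>)"
  have H: "H \<in> carrier_mat (2 * \<nu>) (2 * \<nu>)"
    by (simp add: H_def mult_2)
  note D = is_Delta_carrier[OF \<Delta>]
  have S: "S_mat \<nu> \<Delta> = four_block_mat H (0\<^sub>m (2 * \<nu>) \<delta>) (0\<^sub>m \<delta> (2 * \<nu>)) \<Delta>"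
    unfolding S_mat_def H_def[symmetric] diag_block_mat.simps(2)[of H] diag_block_mat_singleton
      Let_def
    using H D by simp
  have "H\<^sup>T = H"
    unfolding H_def by (subst transpose_four_block_mat) auto
  then have "(S_mat \<nu> \<Delta>)\<^sup>T = S_mat \<nu> \<Delta>"
    unfolding S using is_Delta_symmetric[OF \<Delta>] by (subst transpose_four_block_mat[OF H _ _ D]) auto
  moreover have "H * H = 1\<^sub>m (2 * \<nu>)"
    unfolding H_def by (subst mult_four_block_mat[of _ \<nu> \<nu> _ \<nu> _ \<nu> _ _ \<nu> _ \<nu>]) (auto simp: mult_2)
  then have "det H * det H = 1"
    using det_mult[OF H H] by simp
  then have "det (S_mat \<nu> \<Delta>) \<noteq> 0"
    unfolding S using is_Delta_det[OF \<Delta> z] det_four_block_mat_upper_right_zero[OF H refl _ D] by auto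
  moreover have "S_mat \<nu> \<Delta> \<in> carrier_mat (2 * \<nu> + \<delta>) (2 * \<nu> + \<delta>)"
    unfolding S using H D by simp
  ultimately show ?thesis
    by unfold_locales
qed

theorem theorem2p1:
  fixes z :: "'a :: {finite, field}" and \<nu> \<delta> :: nat and \<Delta> :: "'a mat"
  assumes "odd CHAR('a)"
    and "z \<noteq> 0" and "\<nexists>y. z = y ^ 2"
    and "\<delta> \<in> {0, 1, 2}"
    and "is_Delta z \<delta> \<Delta>"
    and "2 * \<nu> + \<delta> \<ge> 2"
  shows "(Digraph_Component.connected (with_proj (Oi \<nu> \<delta> \<Delta>)) \<longleftrightarrow> 2 * \<nu> + \<delta> \<ge> 3) \<and>
         (Digraph_Component.connected (with_proj (Oi \<nu> \<delta> \<Delta>)) \<longrightarrow>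
            diameter (with_proj (Oi \<nu> \<delta> \<Delta>)) = 4)"
proof -
  interpret nondegenerate_symmetric_form "2 * \<nu> + \<delta>" "S_mat \<nu> \<Delta>"
    using nondegenerate_symmetric_form_S_mat[OF assms(5,2)] .
  show ?thesis
  proof (cases "3 \<le> 2 * \<nu> + \<delta>")
    case True
    then show ?thesis
      using connected_inner_product_graph diameter_inner_product_graph by (simp add: Oi_def)
  next
    case False
    then have "2 * \<nu> + \<delta> = 2"
      using assms(6) by simp
    then show ?thesis
      using not_connected_dim_2 False by (simp add: Oi_def)
  qed
qed

end
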